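(* Let the sequences $(u_n)_{n\ge0}$ and $(v_n)_{n\ge 0}$ be defined by $$\frac{3^{5}}{504}\bigl(E_{6}(q^{3})-E_{6}(q)\bigr)=\sum_{n=0}^{\infty}u_{n}q^{n}, \qquad 27q\,(q^{3};q^{3})_{\infty}^{6}(q;q)_{\infty}^{6}=\sum_{n=0}^{\infty}v_{n}q^{n}.$$ Then for all nonnegative integers $\ell$ and $n$, $$u_{3^{\ell}n}\equiv 0 \pmod{3^{5\ell}}, \qquad v_{3^{\ell}n}\equiv 0 \pmod{3^{2\ell}}.$$
   Context: For $|q|<1$, $(q;q)_\infty=\prod_{n=1}^{\infty}(1-q^n)$ and $(q^3;q^3)_\infty=\prod_{n=1}^\infty(1-q^{3n})$. $E_6$ is the normalized Eisenstein series of weight $6$ for the full modular group: $E_{2k}(q)=1+\frac{2}{\zeta(1-2k)}\sum_{n=1}^\infty\frac{n^{2k-1}q^n}{1-q^n}$ with $\zeta$ the Riemann zeta function, so that $E_6(q)=1-504\sum_{n=1}^{\infty}\frac{n^5q^n}{1-q^n}$. *)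

theory Defs
  imports "HOL-Analysis.Analysis" "HOL-Number_Theory.Cong"
begin

text \<open>The functions below are the intended ones only for \<^term>\<open>norm q < 1\<close>.\<close>

text \<open>
  The \<open>q\<close>-Pochhammer symbol \<open>(a; q)\<^sub>\<infinity>\<close>, the product of the factors \<open>1 - a q\<^sup>n\<close> over \<open>n \<ge> 0\<close>.
  Hence \<open>qpochhammer_inf q q\<close> is the product of \<open>1 - q\<^sup>n\<close> over \<open>n \<ge> 1\<close>.
\<close>

definition qpochhammer_inf :: "complex \<Rightarrow> complex \<Rightarrow> complex" where
  "qpochhammer_inf a q = (\<Prod>n. 1 - a * q ^ n)"

text \<open>
  The Eisenstein series of weight 6 as a function of the nome. The factor \<open>-504\<close> is
  \<open>2 / \<zeta>(1 - 2k)\<close> at \<open>k = 3\<close>, since \<open>\<zeta>(-5) = -1/252\<close>. The sum runs over \<open>Suc n \<ge> 1\<close>.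
\<close>

definition Eisenstein_E6 :: "complex \<Rightarrow> complex" where
  "Eisenstein_E6 q =
     1 - 504 * (\<Sum>n. of_nat (Suc n) ^ 5 * q ^ Suc n / (1 - q ^ Suc n))"

end

theory Submission
  imports
    Defs
    "HOL-Complex_Analysis.Laurent_Convergence"
    "HOL-Library.Nat_Bijection"
    "HOL-Real_Asymp.Real_Asymp"
begin

text \<open>
  Both congruences come from exact formulas for the coefficients.

  For \<open>u\<close>, expanding the Lambert series gives
  \<open>u n = 3 ^ 5 * (\<sigma>\<^sub>5 n - \<sigma>\<^sub>5 (n / 3))\<close>, the second term being present only if \<open>3 dvd n\<close>.
  At the index \<open>3 ^ l * n\<close> with \<open>l \<ge> 1\<close> the difference is the sum of \<open>d ^ 5\<close> over those divisors \<open>d\<close> of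
  \<open>3 ^ l * n\<close> that do not divide \<open>3 ^ (l - 1) * n\<close>. Such a \<open>d\<close> carries the full power of \<open>3\<close>, so it is
  divisible by \<open>3 ^ l\<close> (lemmas \<open>lambert_series_sums\<close> and \<open>divisor_power_sum_diff_dvd\<close>).

  For \<open>v\<close>, the function is \<open>27 \<eta>(z)\<^sup>6 \<eta>(3z)\<^sup>6\<close>, where \<open>\<eta>\<close> is the Dedekind eta function. It is an
  eigenfunction of the operator \<open>\<Sum> a n q\<^sup>n \<mapsto> \<Sum> a (3 n) q\<^sup>n\<close> with eigenvalue \<open>9\<close>, so
  \<open>v (3 ^ l * n) = 9 ^ l * v n\<close>. Modular forms are avoided as follows. By Jacobi's identity,
  \<open>F = (q;q)\<^sub>\<infinity>\<^sup>3\<close> is the sum of \<open>(-1)\<^sup>m (2m+1) q\<^bsup>m(m+1)/2\<^esup>\<close>. A triangular number \<open>m(m+1)/2\<close> is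
  \<open>0\<close> modulo \<open>3\<close> unless \<open>m = 3k+1\<close>, when it equals \<open>9 k(k+1)/2 + 1\<close>; hence
  \<open>F(q) = C(q\<^sup>3) - 3 q F(q\<^sup>9)\<close> for some power series \<open>C\<close>. In \<open>q F(q)\<^sup>2\<close> the only exponents divisible by \<open>3\<close>
  then come from \<open>9 q\<^sup>3 F(q\<^sup>9)\<^sup>2\<close>, and the operator sends \<open>q F(q)\<^sup>2\<close> to \<open>9 q F(q\<^sup>3)\<^sup>2\<close>. Since it treats
  functions of \<open>q\<^sup>3\<close> as scalars, it sends \<open>27 q F(q\<^sup>3)\<^sup>2 F(q)\<^sup>2\<close> to \<open>27 F(q)\<^sup>2 \<cdot> 9 q F(q\<^sup>3)\<^sup>2\<close>, nine times
  the series it started from (lemma \<open>fps_trisect_eta_product\<close>).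

  Jacobi's identity is the limit \<open>n \<rightarrow> \<infinity>\<close> of a finite identity (lemma \<open>jacobi_finite\<close>), which is proved by
  induction on \<open>n\<close> from a recurrence relating neighbouring summands.
\<close>

section \<open>Power series expansions on the unit disc\<close>

text \<open>
  The two hypotheses of the theorem are turned into equalities of formal power series by this lemma and the
  uniqueness of power series expansions.
\<close>
lemma has_fps_expansion_of_sums_in_unit_disc:
  fixes a :: "nat \<Rightarrow> complex"
  assumes "\<And>q. norm q < 1 \<Longrightarrow> (\<lambda>n. a n * q ^ n) sums f q"
  shows "f has_fps_expansion Abs_fps a"
proof (rule has_fps_expansionI)
  have "eventually (\<lambda>q. q \<in> ball 0 1) (nhds (0 :: complex))"
    by (intro eventually_nhds_in_open) auto
  thus "eventually (\<lambda>q. (\<lambda>n. fps_nth (Abs_fps a) n * q ^ n) sums f q) (nhds 0)"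
    by eventually_elim (use assms in simp)
qed

lemma has_fps_expansion_compose_cube:
  assumes "f has_fps_expansion (F :: complex fps)"
  shows "(\<lambda>q. f (q ^ 3)) has_fps_expansion (F oo fps_X ^ 3)"
  using has_fps_expansion_compose[OF assms has_fps_expansion_fps_X_power[of 3]] by (simp add: o_def)

lemma summable_power_times_geometric:
  fixes x :: real
  assumes "0 \<le> x" "x < 1"
  shows "summable (\<lambda>n. (real n + 1) ^ k * x ^ n)"
proof -
  have "(\<lambda>n. ((real n + 2) / (real n + 1)) ^ k * x) \<longlonglongrightarrow> 1 ^ k * x"
    by (intro tendsto_intros) real_asymp
  moreover have "1 ^ k * x < (1 + x) / 2" using assms by simp
  ultimately have "eventually (\<lambda>n. ((real n + 2) / (real n + 1)) ^ k * x < (1 + x) / 2) sequentially"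
    by (rule order_tendstoD)
  then obtain N where N: "\<And>n. n \<ge> N \<Longrightarrow> ((real n + 2) / (real n + 1)) ^ k * x < (1 + x) / 2"
    by (auto simp: eventually_at_top_linorder)
  show ?thesis
  proof (rule summable_ratio_test)
    show "(1 + x) / 2 < 1" using assms by simp
    fix n assume "n \<ge> N"
    have "(real (Suc n) + 1) ^ k * x ^ Suc n =
        (((real n + 2) / (real n + 1)) ^ k * x) * ((real n + 1) ^ k * x ^ n)"
      by (simp add: power_divide field_simps)
    also have "\<dots> \<le> (1 + x) / 2 * ((real n + 1) ^ k * x ^ n)"
      using N[OF \<open>n \<ge> N\<close>] assms by (intro mult_right_mono) auto
    finally show "norm ((real (Suc n) + 1) ^ k * x ^ Suc n) \<le> (1 + x) / 2 * norm ((real n + 1) ^ k * x ^ n)"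
      using assms by simp
  qed
qed

section \<open>Divisor sums and Lambert series\<close>

lemma geometric_Suc_sums:
  fixes z :: "'a::{real_normed_field,banach}"
  assumes "norm z < 1"
  shows "(\<lambda>n. z ^ Suc n) sums (z / (1 - z))"
  using sums_mult[OF geometric_sums[OF assms], of z] by simp

lemma geometric_Suc_has_sum:
  fixes z :: "'a::{real_normed_field,banach}"
  assumes "norm z < 1"
  shows "((\<lambda>n. z ^ Suc n) has_sum (z / (1 - z))) UNIV"
  using assms geometric_Suc_sums[OF assms] geometric_Suc_sums[of "norm z"]
  by (intro norm_summable_imp_has_sum) (auto simp: sums_iff norm_mult norm_power)

text \<open>
  At \<open>n = 0\<close> the sum runs over an infinite set, so its value is \<open>0\<close>: the constant term that a Lambert series needs.
\<close>
definition divisor_power_sum :: "nat \<Rightarrow> nat \<Rightarrow> nat" where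
  "divisor_power_sum k n = (\<Sum>d | d dvd n. d ^ k)"

lemma divisor_power_sum_0 [simp]: "divisor_power_sum k 0 = 0"
  by (simp add: divisor_power_sum_def)

text \<open>
  Each summand is a geometric series, and the resulting absolutely summable double series of
  \<open>d ^ k * q ^ (d * m)\<close> over \<open>d, m \<ge> 1\<close> is regrouped according to \<open>n = d * m\<close>.
\<close>
lemma lambert_series_sums:
  fixes q :: complex
  assumes q: "norm q < 1"
  shows "(\<lambda>n. of_nat (divisor_power_sum k n) * q ^ n) sums
           (\<Sum>n. of_nat (Suc n) ^ k * q ^ Suc n / (1 - q ^ Suc n))"
proof -
  define f :: "nat \<times> nat \<Rightarrow> complex" where
    "f = (\<lambda>(i, j). of_nat (Suc i) ^ k * (q ^ Suc i) ^ Suc j)"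
  define L where "L = (\<lambda>n. of_nat (Suc n) ^ k * q ^ Suc n / (1 - q ^ Suc n))"
  have qS: "norm q ^ Suc n \<le> norm q" for n
    using q by (simp add: mult_left_le power_le_one)
  have qS1: "norm (q ^ Suc n) < 1" for n
    using qS[of n] q by (simp only: norm_power)
  have inner: "((\<lambda>j. f (i, j)) has_sum L i) UNIV" for i
    using has_sum_cmult_right[OF geometric_Suc_has_sum[OF qS1[of i]], of "of_nat (Suc i) ^ k"]
    by (simp add: f_def L_def)
  have norm_inner: "((\<lambda>j. norm (f (i, j))) has_sum
      (real (Suc i) ^ k * (norm q ^ Suc i / (1 - norm q ^ Suc i)))) UNIV" for i
    using has_sum_cmult_right[OF geometric_Suc_has_sum[of "norm q ^ Suc i"], of "real (Suc i) ^ k"] qS1[of i]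
    by (simp add: f_def norm_mult norm_power del: power_Suc of_nat_Suc)
  define B where "B = (\<lambda>n. (real n + 1) ^ k * norm q ^ n * (norm q / (1 - norm q)))"
  have summB: "summable B"
    unfolding B_def using q by (intro summable_mult2 summable_power_times_geometric) auto
  have LB: "real (Suc i) ^ k * (norm q ^ Suc i / (1 - norm q ^ Suc i)) \<le> B i" for i
  proof -
    have "norm q ^ Suc i / (1 - norm q ^ Suc i) \<le> norm q ^ Suc i / (1 - norm q)"
      using qS[of i] q by (intro divide_left_mono mult_pos_pos) (auto simp del: power_Suc)
    hence "real (Suc i) ^ k * (norm q ^ Suc i / (1 - norm q ^ Suc i)) \<le>
        real (Suc i) ^ k * (norm q ^ Suc i / (1 - norm q))"
      by (intro mult_left_mono) auto
    also have "\<dots> = B i" by (simp add: B_def algebra_simps)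
    finally show ?thesis .
  qed
  have pos: "real (Suc i) ^ k * (norm q ^ Suc i / (1 - norm q ^ Suc i)) \<ge> 0" for i
    using qS[of i] q by (intro mult_nonneg_nonneg divide_nonneg_nonneg) (auto simp del: power_Suc)
  have "summable (\<lambda>i. norm (real (Suc i) ^ k * (norm q ^ Suc i / (1 - norm q ^ Suc i))))"
    using LB pos by (intro summable_comparison_test'[OF summB, of 0]) (simp only: real_norm_def abs_abs abs_of_nonneg)
  hence "(\<lambda>i. real (Suc i) ^ k * (norm q ^ Suc i / (1 - norm q ^ Suc i))) summable_on UNIV"
    by (rule norm_summable_imp_summable_on)
  hence "(\<lambda>x. norm (f x)) summable_on (UNIV \<times> UNIV)"
    by (intro summable_on_SigmaI[OF norm_inner]) auto
  hence summ: "f summable_on (UNIV \<times> UNIV)"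
    by (rule abs_summable_summable)
  have normL: "norm (L i) \<le> B i" for i
  proof -
    have "1 - norm q ^ Suc i \<le> norm (1 - q ^ Suc i)"
      using norm_triangle_ineq2[of 1 "q ^ Suc i"] by (simp add: norm_mult norm_power)
    hence "norm (L i) \<le> real (Suc i) ^ k * norm q ^ Suc i / (1 - norm q ^ Suc i)"
      unfolding L_def norm_divide norm_mult norm_power norm_of_nat
      using qS[of i] q by (intro divide_left_mono mult_pos_pos) (auto simp del: power_Suc of_nat_Suc)
    thus ?thesis using LB[of i] by (simp del: power_Suc of_nat_Suc)
  qed
  have sumL: "(L has_sum suminf L) UNIV"
  proof (rule norm_summable_imp_has_sum)
    show *: "summable (\<lambda>n. norm (L n))"
      using normL by (intro summable_comparison_test'[OF summB, of 0]) simp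
    show "L sums suminf L" using summable_norm_cancel[OF *] by (rule summable_sums)
  qed
  have "(f has_sum suminf L) (UNIV \<times> UNIV)"
    using inner sumL summ by (rule has_sum_SigmaI)
  also have "?this \<longleftrightarrow> ((\<lambda>(n, d). of_nat d ^ k * q ^ n) has_sum suminf L)
      (SIGMA n:UNIV. {d. n \<noteq> 0 \<and> d dvd n})"
    by (rule has_sum_reindex_bij_witness[of _ "\<lambda>(n, d). (d - 1, n div d - 1)"
          "\<lambda>(i, j). (Suc i * Suc j, Suc i)"])
       (auto simp: f_def power_mult[symmetric] elim!: dvdE simp del: of_nat_Suc power_Suc mult_Suc mult_Suc_right)
  finally have "((\<lambda>n. of_nat (divisor_power_sum k n) * q ^ n) has_sum suminf L) UNIV"
  proof (rule has_sum_SigmaD)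
    fix n :: nat
    have "{d. n \<noteq> 0 \<and> d dvd n} = (if n = 0 then {} else {d. d dvd n})" by auto
    thus "((\<lambda>d. case (n, d) of (n, d) \<Rightarrow> of_nat d ^ k * q ^ n) has_sum
        of_nat (divisor_power_sum k n) * q ^ n) {d. n \<noteq> 0 \<and> d dvd n}"
      using has_sum_finite[of "{d. d dvd n}" "\<lambda>d. of_nat d ^ k * q ^ n"]
      by (cases "n = 0") (auto simp: divisor_power_sum_def sum_distrib_right)
  qed
  thus ?thesis unfolding L_def by (rule has_sum_imp_sums)
qed

text \<open>
  If \<open>p ^ Suc l * n = d * e\<close>, then \<open>p\<close> cannot divide \<open>e\<close>, as \<open>d\<close> would otherwise divide \<open>p ^ l * n\<close>. So the
  whole factor \<open>p ^ Suc l\<close> lies in \<open>d\<close>.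
\<close>
lemma power_dvd_of_dvd_mult_prime:
  fixes p :: nat
  assumes "prime p" "d dvd p ^ Suc l * n" "\<not> d dvd p ^ l * n"
  shows "p ^ Suc l dvd d"
proof -
  obtain e where e: "p ^ Suc l * n = d * e" using assms(2) by (elim dvdE)
  have "\<not> p dvd e"
  proof
    assume "p dvd e"
    then obtain e' where "e = p * e'" by (elim dvdE)
    with e have "p * (p ^ l * n) = p * (d * e')" by (simp add: mult_ac)
    with \<open>prime p\<close> have "p ^ l * n = d * e'" by (simp add: prime_gt_0_nat)
    with assms(3) show False by simp
  qed
  with \<open>prime p\<close> have "coprime (p ^ Suc l) e"
    by (intro coprime_power_left_iff[THEN iffD2]) (simp add: prime_imp_coprime)
  moreover have "p ^ Suc l dvd d * e" using e by (metis dvd_triv_left)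
  ultimately show ?thesis by (simp only: coprime_dvd_mult_left_iff)
qed

lemma divisor_power_sum_diff_dvd:
  fixes p :: nat
  assumes "prime p"
  shows "int p ^ (k * Suc l) dvd
    int (divisor_power_sum k (p ^ Suc l * n)) - int (divisor_power_sum k (p ^ l * n))"
proof (cases "n = 0")
  case False
  let ?A = "{d. d dvd p ^ Suc l * n}" and ?B = "{d. d dvd p ^ l * n}"
  have "?B \<subseteq> ?A" by (auto intro: dvd_trans)
  moreover have "finite ?A" using False assms by (intro finite_divisors_nat) (auto simp: prime_gt_0_nat)
  ultimately have "int (divisor_power_sum k (p ^ Suc l * n)) - int (divisor_power_sum k (p ^ l * n)) =
      (\<Sum>d\<in>?A - ?B. int d ^ k)"
    by (simp add: divisor_power_sum_def sum_diff)
  also have "int p ^ (k * Suc l) dvd \<dots>"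
  proof (rule dvd_sum)
    fix d assume "d \<in> ?A - ?B"
    hence "p ^ Suc l dvd d" using power_dvd_of_dvd_mult_prime[OF assms] by blast
    hence "int p ^ Suc l dvd int d" by (metis of_nat_dvd_iff of_nat_power)
    hence "(int p ^ Suc l) ^ k dvd int d ^ k" by (rule dvd_power_same)
    thus "int p ^ (k * Suc l) dvd int d ^ k" by (simp only: power_mult[symmetric] mult.commute[of k])
  qed
  finally show ?thesis .
qed simp

lemma E6_difference_has_fps_expansion:
  "(\<lambda>q. 3 ^ 5 / 504 * (Eisenstein_E6 (q ^ 3) - Eisenstein_E6 q)) has_fps_expansion
     Abs_fps (\<lambda>n. 3 ^ 5 * of_int (int (divisor_power_sum 5 n) -
       (if 3 dvd n then int (divisor_power_sum 5 (n div 3)) else 0)))"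
proof -
  define L :: "complex \<Rightarrow> complex" where
    "L = (\<lambda>q. \<Sum>n. of_nat (Suc n) ^ 5 * q ^ Suc n / (1 - q ^ Suc n))"
  define S :: "complex fps" where "S = Abs_fps (\<lambda>n. of_nat (divisor_power_sum 5 n))"
  have L: "L has_fps_expansion S"
    unfolding L_def S_def by (intro has_fps_expansion_of_sums_in_unit_disc lambert_series_sums)
  have "(\<lambda>q. 3 ^ 5 * (L q - L (q ^ 3))) has_fps_expansion fps_const (3 ^ 5) * (S - (S oo fps_X ^ 3))"
    by (intro has_fps_expansion_cmult_left has_fps_expansion_diff L has_fps_expansion_compose_cube)
  also have "(\<lambda>q. 3 ^ 5 * (L q - L (q ^ 3))) = (\<lambda>q. 3 ^ 5 / 504 * (Eisenstein_E6 (q ^ 3) - Eisenstein_E6 q))"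
    unfolding Eisenstein_E6_def L_def[symmetric] L_def[THEN fun_cong, symmetric] by (simp add: algebra_simps)
  also have "fps_const (3 ^ 5) * (S - (S oo fps_X ^ 3)) =
     Abs_fps (\<lambda>n. 3 ^ 5 * of_int (int (divisor_power_sum 5 n) -
       (if 3 dvd n then int (divisor_power_sum 5 (n div 3)) else 0)))"
    by (auto simp: fps_eq_iff fps_nth_compose_X_power S_def)
  finally show ?thesis .
qed

section \<open>Jacobi's identity for the cube of the Euler product\<close>

lemma strict_mono_triangle: "strict_mono triangle"
  by (intro strict_monoI_Suc) simp

lemma inj_triangle: "inj triangle"
  using strict_mono_triangle by (rule strict_mono_imp_inj_on)

lemma le_triangle: "n \<le> triangle n"
  by (induction n) auto

text \<open>
  Jacobi's series \<open>\<Sum> (-1)\<^sup>m (2 m + 1) X\<^bsup>m(m+1)/2\<^esup>\<close> for \<open>(q;q)\<^sub>\<infinity>\<^sup>3\<close>, with its coefficients read off through the inverse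
  of the injection \<open>triangle\<close>.
\<close>
definition jacobi_fps :: "complex fps" where
  "jacobi_fps = Abs_fps (\<lambda>n. if n \<in> range triangle
     then (-1) ^ inv triangle n * of_nat (2 * inv triangle n + 1) else 0)"

lemma jacobi_fps_nth_triangle [simp]:
  "fps_nth jacobi_fps (triangle m) = (-1) ^ m * of_nat (2 * m + 1)"
  by (simp add: jacobi_fps_def inv_f_f[OF inj_triangle])

lemma jacobi_fps_nth_eq_0: "n \<notin> range triangle \<Longrightarrow> fps_nth jacobi_fps n = 0"
  by (simp add: jacobi_fps_def)

lemma jacobi_fps_nth_Ints: "fps_nth jacobi_fps n \<in> \<int>"
  by (simp add: jacobi_fps_def)

definition qpochhammer_fin :: "complex \<Rightarrow> nat \<Rightarrow> complex" where
  "qpochhammer_fin q n = (\<Prod>i<n. 1 - q * q ^ i)"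

lemma qpochhammer_fin_0 [simp]: "qpochhammer_fin q 0 = 1"
  by (simp add: qpochhammer_fin_def)

lemma qpochhammer_fin_Suc [simp]:
  "qpochhammer_fin q (Suc n) = qpochhammer_fin q n * (1 - q ^ Suc n)"
  by (simp add: qpochhammer_fin_def)

context
  fixes q :: complex
  assumes q: "norm q < 1"
begin

lemma one_minus_power_nonzero: "1 - q ^ Suc n \<noteq> 0"
proof
  assume "1 - q ^ Suc n = 0"
  hence "norm (q ^ Suc n) = 1" by simp
  moreover have "norm q ^ Suc n \<le> norm q" using q by (simp add: mult_left_le power_le_one)
  ultimately show False using q by (simp only: norm_power)
qed

lemma qpochhammer_fin_nonzero: "qpochhammer_fin q n \<noteq> 0"
  by (induction n) (use one_minus_power_nonzero in auto)

lemma convergent_prod_qpochhammer: "convergent_prod (\<lambda>n. 1 - q * q ^ n)"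
proof -
  have "summable (\<lambda>n. norm (- q * q ^ n))"
    using q by (simp add: norm_mult norm_power summable_mult)
  hence "convergent_prod (\<lambda>n. 1 + (- q * q ^ n))"
    by (intro abs_convergent_prod_imp_convergent_prod summable_imp_abs_convergent_prod) simp
  thus ?thesis by simp
qed

lemma qpochhammer_inf_nonzero: "qpochhammer_inf q q \<noteq> 0"
  unfolding qpochhammer_inf_def
  using one_minus_power_nonzero by (intro prodinf_nonzero convergent_prod_qpochhammer) simp

lemma qpochhammer_fin_tendsto: "qpochhammer_fin q \<longlonglongrightarrow> qpochhammer_inf q q"
  unfolding qpochhammer_inf_def qpochhammer_fin_def
  using convergent_prod_LIMSEQ[OF convergent_prod_qpochhammer]
  by (subst filterlim_sequentially_Suc[symmetric]) (simp add: lessThan_Suc_atMost)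

text \<open>
  Substituting \<open>z = 1\<close> into the finite Jacobi triple product, whose factors are \<open>(1 - z q\<^sup>k) (1 - q\<^sup>k / z)\<close> for
  \<open>1 \<le> k \<le> n\<close>, collapses \<open>z\<^bsup>-j\<^esup> + \<dots> + z\<^sup>j\<close> to \<open>2 j + 1\<close>. The summands below are its coefficients,
  divided by \<open>(q;q)\<^bsub>2n+1\<^esub>\<close>; as functions of \<open>j\<close> they would extend to negative \<open>j\<close> by
  \<open>a (- 1 - j) = - a j\<close>.
\<close>
definition jacobi_term :: "nat \<Rightarrow> nat \<Rightarrow> complex" where
  "jacobi_term n j = (if j \<le> n then (-1) ^ j * q ^ triangle j /
     (qpochhammer_fin q (n - j) * qpochhammer_fin q (n + 1 + j)) else 0)"

lemma jacobi_term_eq_0: "n < j \<Longrightarrow> jacobi_term n j = 0"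
  by (simp add: jacobi_term_def)

text \<open>
  The polynomial identity behind the recurrence in \<open>n\<close>. It is used with \<open>x = q ^ (n - j)\<close> and
  \<open>y = q ^ (n + 2 + j)\<close>, when all four terms of the recurrence become multiples of the one on its left-hand
  side; the value \<open>j = -1\<close> belongs to the recurrence at index \<open>0\<close>.
\<close>
lemma jacobi_recurrence_identity:
  "(1 - x*y) * (1 - x*y*q) =
   (1 + x*y) * ((1 - x) * (1 - y*q)) + x * (1 - y) * (1 - y*q) + y * (q - x) * (1 - x)"
  by algebra

text \<open>
  Passing from \<open>n\<close> to \<open>n + 1\<close> multiplies the triple product by
  \<open>(1 - z q\<^bsup>n+1\<^esup>) (1 - q\<^bsup>n+1\<^esup> / z) = 1 + q\<^bsup>2n+2\<^esup> - q\<^bsup>n+1\<^esup> (z + 1/z)\<close>, and multiplication by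
  \<open>z + 1/z\<close> shifts the coefficients in both directions.
\<close>
lemma jacobi_term_recurrence_Suc:
  "(1 - q ^ (2*n+2)) * (1 - q ^ (2*n+3)) * jacobi_term (Suc n) (Suc j) =
   (1 + q ^ (2*n+2)) * jacobi_term n (Suc j) - q ^ (n+1) * (jacobi_term n j + jacobi_term n (j + 2))"
proof (cases "j \<le> n")
  case True
  then obtain d where n: "n = j + d" using le_Suc_ex by blast
  define x where "x = q ^ d"
  define y where "y = q ^ (n + 2 + j)"
  define W where "W = jacobi_term (Suc n) (Suc j)"
  have W: "W = - ((-1) ^ j * q ^ triangle j * q ^ Suc j /
      (qpochhammer_fin q d * (qpochhammer_fin q (n + 1 + j) * (1 - y) * (1 - y*q))))"
    by (simp add: W_def jacobi_term_def n y_def power_add numeral_3_eq_3 mult_ac)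
  have y1: "1 - y \<noteq> 0" "1 - y*q \<noteq> 0"
    using one_minus_power_nonzero[of "n + 1 + j"] one_minus_power_nonzero[of "n + 2 + j"]
    by (simp_all add: y_def mult_ac)
  have xy: "q ^ (2*n+2) = x*y"
    unfolding x_def y_def n power_add[symmetric] by (rule arg_cong[where f = "(^) q"]) simp
  have T0: "jacobi_term n (Suc j) = W * ((1 - x) * (1 - y*q))"
  proof (cases d)
    case (Suc e)
    have "1 - x \<noteq> 0" using one_minus_power_nonzero[of e] by (simp add: x_def Suc)
    with y1 show ?thesis unfolding W
      by (simp add: jacobi_term_def n Suc x_def y_def power_add mult_ac)
  qed (simp add: x_def jacobi_term_def n)
  have T1: "q ^ (n+1) * jacobi_term n j = - (W * (x * (1 - y) * (1 - y*q)))"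
    using y1 unfolding W by (simp add: jacobi_term_def n x_def power_add mult_ac)
  have T2: "q ^ (n+1) * jacobi_term n (j + 2) = - (W * (y * (q - x) * (1 - x)))"
    (* The factors q - x and 1 - x vanish for d = 1 and d = 0, when the left-hand side is zero by convention. *)
  proof (cases d)
    case (Suc e)
    show ?thesis
    proof (cases e)
      case e: (Suc e')
      define z where "z = q ^ Suc e'"
      have z: "1 - z \<noteq> 0" "1 - q*z \<noteq> 0" "x = q*z"
        using one_minus_power_nonzero[of e'] one_minus_power_nonzero[of e]
        by (simp_all add: x_def Suc e z_def)
      have "qpochhammer_fin q d = qpochhammer_fin q e' * (1 - z) * (1 - q*z)"
        by (simp add: Suc e z_def)
      moreover have "jacobi_term n (j + 2) = (-1) ^ j * q ^ triangle j * q ^ Suc j * q ^ Suc (Suc j) /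
          (qpochhammer_fin q e' * (qpochhammer_fin q (n + 1 + j) * (1 - y) * (1 - y*q)))"
        by (simp add: jacobi_term_def n Suc e y_def power_add numeral_2_eq_2 mult_ac)
      moreover have "q - x = q * (1 - z)" using z by (simp add: algebra_simps)
      moreover have "q ^ (n+1) * (c * u * v * q ^ Suc (Suc j) / (E * R)) =
          - (- (c * u * v / (E * (1 - z) * (1 - q*z) * R)) * (y * (q * (1 - z)) * (1 - q*z)))" for c u v E R
      proof -
        have "q ^ (n+1) * q ^ Suc (Suc j) = y * q"
          by (simp add: y_def power_add mult_ac power2_eq_square)
        hence "q ^ (n+1) * (c * u * v * q ^ Suc (Suc j) / (E * R)) = c * u * v * (y * q) / (E * R)"
          by (simp del: power_Suc)
        thus ?thesis using z by simp
      qed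
      ultimately show ?thesis
        unfolding W z(3) by (simp only:)
    qed (simp add: x_def jacobi_term_def n Suc)
  qed (simp add: x_def jacobi_term_def n)
  have q3: "q ^ (2*n+3) = x*y*q"
    unfolding xy[symmetric] by (simp add: numeral_3_eq_3)
  show ?thesis
    unfolding distrib_left T0 T1 T2 W_def[symmetric] q3 xy jacobi_recurrence_identity
    by (simp add: algebra_simps)
qed (simp add: jacobi_term_eq_0)

text \<open>
  At \<open>j = 0\<close> the neighbour at index \<open>-1\<close> is replaced by \<open>- jacobi_term n 0\<close>, according to the symmetry
  \<open>a (- 1 - j) = - a j\<close>.
\<close>
lemma jacobi_term_recurrence_0:
  "(1 - q ^ (2*n+2)) * (1 - q ^ (2*n+3)) * jacobi_term (Suc n) 0 =
   (1 + q ^ (2*n+2)) * jacobi_term n 0 - q ^ (n+1) * (jacobi_term n 1 - jacobi_term n 0)"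
proof -
  define x where "x = q ^ (n + 1)"
  define W where "W = jacobi_term (Suc n) 0"
  have W: "W = 1 / (qpochhammer_fin q n * (1 - x) * (qpochhammer_fin q n * (1 - x) * (1 - x*q)))"
    by (simp add: W_def jacobi_term_def x_def mult_ac)
  have x1: "1 - x \<noteq> 0" "1 - x*q \<noteq> 0"
    using one_minus_power_nonzero[of n] one_minus_power_nonzero[of "n + 1"]
    by (simp_all add: x_def mult_ac)
  have T0: "jacobi_term n 0 = W * ((1 - x) * (1 - x*q))"
    using x1 unfolding W by (simp add: jacobi_term_def x_def mult_ac)
  have T1: "q ^ (n+1) * jacobi_term n 1 = - (W * (x * (q - x) * (1 - x)))"
  proof (cases n)
    case (Suc m)
    define z where "z = q ^ n"
    have z: "1 - z \<noteq> 0" "x = q * z"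
      using one_minus_power_nonzero[of m] by (simp_all add: x_def z_def Suc)
    have "jacobi_term n 1 = - q / (qpochhammer_fin q m * (qpochhammer_fin q n * (1 - x) * (1 - x*q)))"
      by (simp add: jacobi_term_def Suc x_def mult_ac numeral_2_eq_2)
    moreover have "qpochhammer_fin q n = qpochhammer_fin q m * (1 - z)"
      by (simp add: Suc z_def)
    moreover have "q ^ (n+1) = x" by (simp add: x_def)
    moreover have "q - x = q * (1 - z)" using z by (simp add: algebra_simps)
    moreover have "x * (- q / (P * (P * C * A * B))) = - (1 / (P * C * A * (P * C * A * B)) * (x * (q * C) * A))"
      if "P \<noteq> 0" "C \<noteq> 0" "A \<noteq> 0" "B \<noteq> 0" for P A B C :: complex
      using that by (simp add: field_simps)
    ultimately show ?thesis
      using z(1) x1 qpochhammer_fin_nonzero[of m] unfolding W by simp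
  qed (simp add: x_def jacobi_term_def)
  have xx: "q ^ (2*n+2) = x*x" "q ^ (2*n+3) = x*x*q"
    by (simp_all add: x_def numeral_3_eq_3 power_mult mult_ac power2_eq_square)
  show ?thesis
    unfolding right_diff_distrib T1 unfolding xx T0 W_def[symmetric] jacobi_recurrence_identity
    by (simp add: x_def algebra_simps)
qed

text \<open>
  Summation by parts: the weights satisfy \<open>(2 j - 1) + (2 j + 3) = 2 (2 j + 1)\<close>, so that up to boundary terms
  adding the two neighbours amounts to doubling.
\<close>
lemma sum_odd_weights_second_difference:
  fixes c :: "nat \<Rightarrow> complex"
  shows "(\<Sum>j\<le>m. of_nat (2*j+1) * (case j of 0 \<Rightarrow> c 1 - c 0 | Suc i \<Rightarrow> c i + c (i + 2))) =
    2 * (\<Sum>j\<le>m. of_nat (2*j+1) * c j) + of_nat (2*m+1) * c (m+1) - of_nat (2*m+3) * c m"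
  by (induction m) (simp_all add: algebra_simps)

text \<open>
  By the recurrence and the summation by parts, \<open>(1 - q\<^bsup>2n+2\<^esup>) (1 - q\<^bsup>2n+3\<^esup>)\<close> times the sum for \<open>n + 1\<close> is
  \<open>1 + q\<^bsup>2n+2\<^esup> - 2 q\<^bsup>n+1\<^esup> = (1 - q\<^bsup>n+1\<^esup>)\<^sup>2\<close> times the sum for \<open>n\<close>.
\<close>
lemma jacobi_finite:
  "(\<Sum>j\<le>n. of_nat (2*j+1) * jacobi_term n j) = qpochhammer_fin q n ^ 2 / qpochhammer_fin q (2*n+1)"
proof (induction n)
  case 0
  show ?case using one_minus_power_nonzero[of 0] by (simp add: jacobi_term_def)
next
  case (Suc n)
  let ?S = "\<lambda>n. \<Sum>j\<le>n. of_nat (2*j+1) * jacobi_term n j"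
  let ?D = "(1 - q ^ (2*n+2)) * (1 - q ^ (2*n+3))"
  let ?\<Delta> = "\<lambda>j. case j of 0 \<Rightarrow> jacobi_term n 1 - jacobi_term n 0
                 | Suc i \<Rightarrow> jacobi_term n i + jacobi_term n (i + 2)"
  have top: "(\<Sum>j\<le>Suc n. of_nat (2*j+1) * jacobi_term n j) = ?S n"
    by (simp add: jacobi_term_eq_0)
  have rec: "?D * jacobi_term (Suc n) j = (1 + q ^ (2*n+2)) * jacobi_term n j - q ^ (n+1) * ?\<Delta> j" for j
    using jacobi_term_recurrence_0[of n] jacobi_term_recurrence_Suc[of n] by (cases j) simp_all
  have "?D * ?S (Suc n) = (\<Sum>j\<le>Suc n. of_nat (2*j+1) * (?D * jacobi_term (Suc n) j))"
    by (simp only: sum_distrib_left mult_ac)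
  also have "\<dots> = (1 + q ^ (2*n+2)) * (\<Sum>j\<le>Suc n. of_nat (2*j+1) * jacobi_term n j)
      - q ^ (n+1) * (\<Sum>j\<le>Suc n. of_nat (2*j+1) * ?\<Delta> j)"
    unfolding rec sum_distrib_left sum_subtractf[symmetric]
    by (intro sum.cong refl) (simp only: right_diff_distrib mult_ac)
  also have "(\<Sum>j\<le>Suc n. of_nat (2*j+1) * ?\<Delta> j) = 2 * ?S n"
    unfolding sum_odd_weights_second_difference top by (simp add: jacobi_term_eq_0)
  also have "(1 + q ^ (2*n+2)) * (\<Sum>j\<le>Suc n. of_nat (2*j+1) * jacobi_term n j) - q ^ (n+1) * (2 * ?S n)
      = (1 - q ^ Suc n) ^ 2 * ?S n"
  proof -
    have "(1 + q ^ (2*n+2)) * s - q ^ (n+1) * (2 * s) = (1 - q ^ Suc n) ^ 2 * s" for s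
    proof -
      have "q ^ (2*n+2) = q ^ Suc n * q ^ Suc n"
        unfolding power_add[symmetric] by (rule arg_cong[where f = "(^) q"]) simp
      moreover have "(1 + x * x) * s - x * (2 * s) = (1 - x) ^ 2 * s" for x :: complex
        by (simp add: power2_eq_square algebra_simps)
      ultimately show ?thesis by (simp only: Suc_eq_plus1)
    qed
    thus ?thesis unfolding top .
  qed
  also have "?S n = qpochhammer_fin q n ^ 2 / qpochhammer_fin q (2*n+1)" by (rule Suc.IH)
  finally have DS: "?D * ?S (Suc n) =
      (1 - q ^ Suc n) ^ 2 * (qpochhammer_fin q n ^ 2 / qpochhammer_fin q (2*n+1))" .
  have D: "?D \<noteq> 0"
    using one_minus_power_nonzero[of "2*n+1"] one_minus_power_nonzero[of "2*n+2"]
    by (simp add: numeral_3_eq_3)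
  have "s = b * a / (c * d)" if "d * s = a * (b / c)" "d \<noteq> 0" for a b c d s :: complex
    using that by (metis nonzero_mult_div_cancel_left divide_divide_eq_left times_divide_eq_right mult.commute)
  from this[OF DS D] show ?case
    by (simp add: power_mult_distrib numeral_3_eq_3 mult_ac)
qed

text \<open>
  Jacobi's identity. In the finite identity every term tends to
  \<open>(-1)\<^sup>j (2 j + 1) q\<^bsup>j(j+1)/2\<^esup> / (q;q)\<^sub>\<infinity>\<^sup>2\<close> and the right-hand side to \<open>(q;q)\<^sub>\<infinity>\<close>. Tannery's theorem
  permits the termwise limit, because the reciprocals of the finite products are bounded.
\<close>
lemma jacobi_fps_sums: "(\<lambda>n. fps_nth jacobi_fps n * q ^ n) sums (qpochhammer_inf q q ^ 3)"
proof -
  let ?P = "qpochhammer_inf q q"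
  define b where "b = (\<lambda>j. (-1) ^ j * of_nat (2*j+1) * q ^ triangle j)"
  have "Bseq (\<lambda>n. inverse (qpochhammer_fin q n))"
    using qpochhammer_fin_tendsto qpochhammer_inf_nonzero
    by (intro convergent_imp_Bseq convergentI[OF tendsto_inverse[of _ ?P]])
  then obtain K where K: "K > 0" "\<And>n. norm (inverse (qpochhammer_fin q n)) \<le> K"
    by (auto simp: Bseq_def)
  define M where "M = (\<lambda>j. 2 * ((real j + 1) ^ 1 * norm q ^ j) * (K * K))"
  have lim: "(\<lambda>n. of_nat (2*j+1) * jacobi_term n j) \<longlonglongrightarrow> b j / ?P ^ 2" for j
  proof -
    have "(\<lambda>n. qpochhammer_fin q (n - j)) \<longlonglongrightarrow> ?P"
      by (rule LIMSEQ_offset[of _ j]) (simp add: qpochhammer_fin_tendsto)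
    moreover have "(\<lambda>n. qpochhammer_fin q (n + 1 + j)) \<longlonglongrightarrow> ?P"
      using LIMSEQ_ignore_initial_segment[OF qpochhammer_fin_tendsto, of "1 + j"] by (simp add: add_ac)
    ultimately have "(\<lambda>n. b j / (qpochhammer_fin q (n - j) * qpochhammer_fin q (n + 1 + j)))
        \<longlonglongrightarrow> b j / (?P * ?P)"
      using qpochhammer_inf_nonzero by (intro tendsto_intros) auto
    moreover have "eventually (\<lambda>n. b j / (qpochhammer_fin q (n - j) * qpochhammer_fin q (n + 1 + j)) =
        of_nat (2*j+1) * jacobi_term n j) sequentially"
      using eventually_ge_at_top[of j] by eventually_elim (simp add: b_def jacobi_term_def)
    ultimately show ?thesis by (simp add: power2_eq_square Lim_transform_eventually)
  qed
  have bound: "norm (of_nat (2*j+1) * jacobi_term n j) \<le> M j" for j n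
  proof (cases "j \<le> n")
    case True
    have "norm (of_nat (2*j+1) * jacobi_term n j) = real (2*j+1) * norm q ^ triangle j *
        (norm (inverse (qpochhammer_fin q (n - j))) * norm (inverse (qpochhammer_fin q (n + 1 + j))))"
      using True unfolding jacobi_term_def
      by (simp only: if_True norm_mult norm_divide norm_power norm_inverse norm_minus_cancel norm_one
          power_one norm_of_nat mult_1 divide_inverse inverse_mult_distrib mult_ac)
    also have "\<dots> \<le> (2 * ((real j + 1) ^ 1 * norm q ^ j)) * (K * K)"
    proof (rule mult_mono)
      have "norm q ^ triangle j \<le> norm q ^ j"
        using q by (intro power_decreasing le_triangle) auto
      hence "real (2*j+1) * norm q ^ triangle j \<le> (2 * (real j + 1)) * norm q ^ j"
        by (intro mult_mono) auto
      thus "real (2*j+1) * norm q ^ triangle j \<le> 2 * ((real j + 1) ^ 1 * norm q ^ j)"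
        by (simp only: power_one_right mult.assoc)
      show "norm (inverse (qpochhammer_fin q (n - j))) * norm (inverse (qpochhammer_fin q (n + 1 + j))) \<le> K * K"
        by (intro mult_mono K(2)) (use K(1) in auto)
    qed (use K in auto)
    finally show ?thesis by (simp add: M_def)
  qed (use K in \<open>simp add: jacobi_term_eq_0 M_def\<close>)
  have summM: "summable M"
    unfolding M_def using q
    by (intro summable_mult2 summable_mult summable_power_times_geometric) auto
  have "eventually (\<lambda>(j, n). norm (of_nat (2*j+1) * jacobi_term n j) \<le> M j) (at_top \<times>\<^sub>F sequentially)"
    using bound by (intro always_eventually) auto
  note tan = tannerys_theorem[OF lim this summM sequentially_bot]
  have "(\<Sum>j. of_nat (2*j+1) * jacobi_term n j) = qpochhammer_fin q n ^ 2 / qpochhammer_fin q (2*n+1)" for n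
    unfolding jacobi_finite[symmetric] by (rule suminf_finite) (auto simp: jacobi_term_eq_0)
  moreover have "(\<lambda>n. qpochhammer_fin q n ^ 2 / qpochhammer_fin q (2*n+1)) \<longlonglongrightarrow> ?P ^ 2 / ?P"
  proof -
    have "strict_mono (\<lambda>n::nat. 2*n+1)" by (auto simp: strict_mono_def)
    from LIMSEQ_subseq_LIMSEQ[OF qpochhammer_fin_tendsto this]
    have "(\<lambda>n. qpochhammer_fin q (2*n+1)) \<longlonglongrightarrow> ?P" by (simp add: o_def)
    thus ?thesis using qpochhammer_inf_nonzero by (intro tendsto_intros qpochhammer_fin_tendsto)
  qed
  ultimately have "(\<Sum>j. b j / ?P ^ 2) = ?P"
    using tan qpochhammer_inf_nonzero by (auto simp: power2_eq_square intro: LIMSEQ_unique)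
  moreover have "(\<lambda>j. b j / ?P ^ 2) sums (\<Sum>j. b j / ?P ^ 2)"
    using tan by (intro summable_sums summable_norm_cancel[of "\<lambda>j. b j / ?P ^ 2"]) blast
  ultimately have "(\<lambda>j. b j / ?P ^ 2) sums ?P" by simp
  from sums_mult[OF this, of "?P ^ 2"] have "b sums ?P ^ 3"
    using qpochhammer_inf_nonzero by (simp add: power2_eq_square power3_eq_cube)
  moreover have "b = (\<lambda>j. fps_nth jacobi_fps (triangle j) * q ^ triangle j)"
    by (simp add: b_def)
  ultimately show ?thesis
    by (subst sums_mono_reindex[OF strict_mono_triangle, symmetric]) (simp_all add: jacobi_fps_nth_eq_0)
qed

end

section \<open>Trisection of power series\<close>

text \<open>
  This is the Hecke operator \<open>U\<^sub>3\<close> on \<open>q\<close>-expansions.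
\<close>
definition fps_trisect :: "'a::zero fps \<Rightarrow> 'a fps" where
  "fps_trisect F = Abs_fps (\<lambda>n. fps_nth F (3 * n))"

lemma fps_trisect_nth [simp]: "fps_nth (fps_trisect F) n = fps_nth F (3 * n)"
  by (simp add: fps_trisect_def)

lemma fps_trisect_add: "fps_trisect (F + G) = fps_trisect F + fps_trisect (G :: 'a::comm_ring_1 fps)"
  by (simp add: fps_eq_iff)

text \<open>
  Trisection is linear over power series in \<open>X ^ 3\<close>.
\<close>
lemma fps_trisect_compose_mult:
  fixes F G :: "'a::comm_ring_1 fps"
  shows "fps_trisect ((F oo fps_X ^ 3) * G) = F * fps_trisect G"
proof (rule fps_ext)
  fix n
  have "fps_nth ((F oo fps_X ^ 3) * G) (3 * n) =
      (\<Sum>i = 0..3 * n. (if 3 dvd i then fps_nth F (i div 3) else 0) * fps_nth G (3 * n - i))"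
    by (simp add: fps_mult_nth fps_nth_compose_X_power)
  also have "\<dots> = (\<Sum>i \<in> (*) 3 ` {0..n}. fps_nth F (i div 3) * fps_nth G (3 * n - i))"
    by (intro sum.mono_neutral_cong_right) (auto elim!: dvdE)
  also have "\<dots> = (\<Sum>i = 0..n. fps_nth F i * fps_nth G (3 * n - 3 * i))"
    by (subst sum.reindex) (auto simp: inj_on_def)
  finally show "fps_nth (fps_trisect ((F oo fps_X ^ 3) * G)) n = fps_nth (F * fps_trisect G) n"
    by (simp add: fps_mult_nth diff_mult_distrib2)
qed

section \<open>The 3-dissection of Jacobi's series\<close>

lemma triangle_3_mult_mod: "triangle (3 * k) mod 3 = 0"
proof (induction k)
  case (Suc k)
  have "triangle (3 * Suc k) = triangle (3 * k) + 3 * (3 * k + 2)"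
    by (simp add: numeral_3_eq_3)
  with Suc show ?case by presburger
qed simp

lemma triangle_3_mult_plus_1: "triangle (3 * k + 1) = 9 * triangle k + 1"
proof (induction k)
  case (Suc k)
  have "triangle (3 * Suc k + 1) = triangle (3 * k + 1) + (9 * k + 9)"
    by (simp add: numeral_3_eq_3)
  with Suc show ?case by simp
qed simp

lemma triangle_3_mult_plus_2_mod: "triangle (3 * k + 2) mod 3 = 0"
proof -
  have "triangle (3 * k + 2) = triangle (3 * k) + 3 * (2 * k + 1)"
    by (simp add: numeral_2_eq_2)
  with triangle_3_mult_mod[of k] show ?thesis by presburger
qed

lemma triangle_mod_3_eq_0_or:
  obtains "triangle m mod 3 = 0" | k where "m = 3 * k + 1"
proof -
  have "m = 3 * (m div 3) \<or> m = 3 * (m div 3) + 1 \<or> m = 3 * (m div 3) + 2" by presburger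
  thus ?thesis using that triangle_3_mult_mod triangle_3_mult_plus_2_mod by metis
qed

lemma jacobi_fps_nth_mod_3_eq_2:
  assumes "n mod 3 = 2" shows "fps_nth jacobi_fps n = 0"
proof (rule jacobi_fps_nth_eq_0, safe)
  fix m assume n: "n = triangle m"
  show False
    by (rule triangle_mod_3_eq_0_or[of m])
       (use assms n triangle_3_mult_plus_1 in \<open>auto, presburger\<close>)
qed

text \<open>
  Here \<open>3 n + 1 = triangle m\<close> forces \<open>m = 3 k + 1\<close> and \<open>n = 3 * triangle k\<close>. Then \<open>2 m + 1 = 3 (2 k + 1)\<close>, while
  \<open>m\<close> and \<open>k\<close> have opposite parity; this is the factor \<open>-3\<close>.
\<close>
lemma jacobi_fps_nth_mod_3_eq_1:
  "fps_nth jacobi_fps (3 * n + 1) = (if 3 dvd n then -3 * fps_nth jacobi_fps (n div 3) else 0)"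
proof (cases "3 * n + 1 \<in> range triangle")
  case True
  then obtain m where m: "3 * n + 1 = triangle m" by auto
  then obtain k where k: "m = 3 * k + 1"
    by (cases rule: triangle_mod_3_eq_0_or[of m]) presburger+
  have n: "n = 3 * triangle k"
    using m k triangle_3_mult_plus_1[of k] by simp
  have "fps_nth jacobi_fps (3 * n + 1) = (-1) ^ m * of_nat (2 * m + 1)"
    unfolding m by simp
  moreover have "fps_nth jacobi_fps (n div 3) = (-1) ^ k * of_nat (2 * k + 1)"
    by (simp add: n)
  moreover have "(-1 :: complex) ^ m = - ((-1) ^ k)"
    by (simp add: k minus_one_power_iff)
  ultimately show ?thesis by (simp add: n k algebra_simps)
next
  case False
  have "n div 3 \<notin> range triangle" if "3 dvd n"
  proof
    assume "n div 3 \<in> range triangle"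
    then obtain k where "n div 3 = triangle k" by auto
    with that have "n = 3 * triangle k" by auto
    hence "3 * n + 1 = triangle (3 * k + 1)" by (simp only: triangle_3_mult_plus_1)
    with False show False by blast
  qed
  with False show ?thesis by (simp add: jacobi_fps_nth_eq_0)
qed

lemma jacobi_fps_3_dissection:
  "jacobi_fps = (fps_trisect jacobi_fps oo fps_X ^ 3) - 3 * fps_X * (jacobi_fps oo fps_X ^ 9)"
proof (rule fps_ext)
  fix n
  let ?R = "(fps_trisect jacobi_fps oo fps_X ^ 3) - 3 * fps_X * (jacobi_fps oo fps_X ^ 9)"
  have R: "fps_nth ?R n = (if 3 dvd n then fps_nth jacobi_fps n else 0) -
      3 * (if n = 0 then 0 else if 9 dvd n - 1 then fps_nth jacobi_fps ((n - 1) div 9) else 0)"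
    by (auto simp: fps_nth_compose_X_power mult.assoc numeral_fps_const)
  consider "n mod 3 = 0" | k where "n = 3 * k + 1" | "n mod 3 = 2"
  proof -
    have "n mod 3 = 0 \<or> n = 3 * (n div 3) + 1 \<or> n mod 3 = 2" by presburger
    thus ?thesis using that(1) that(2)[of "n div 3"] that(3) by argo
  qed
  thus "fps_nth jacobi_fps n = fps_nth ?R n"
  proof cases
    case 1
    hence "n \<noteq> 0 \<Longrightarrow> \<not> 9 dvd n - 1" "3 dvd n" by presburger+
    thus ?thesis unfolding R by auto
  next
    case (2 k)
    have "\<not> 3 dvd n" "n \<noteq> 0" using 2 by presburger+
    moreover have "n - 1 = 3 * k" using 2 by simp
    moreover have "9 dvd 3 * k \<longleftrightarrow> 3 dvd k" "3 * k div 9 = k div 3" by presburger+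
    moreover have "fps_nth jacobi_fps n = (if 3 dvd k then -3 * fps_nth jacobi_fps (k div 3) else 0)"
      unfolding 2 by (rule jacobi_fps_nth_mod_3_eq_1)
    ultimately show ?thesis unfolding R by (simp only: if_False if_True) simp
  next
    case 3
    hence "\<not> 3 dvd n" "\<not> 9 dvd n - 1" by presburger+
    thus ?thesis unfolding R using 3 by (simp add: jacobi_fps_nth_mod_3_eq_2)
  qed
qed

lemma fps_compose_X_power_9: "(F :: complex fps) oo fps_X ^ 9 = (F oo fps_X ^ 3) oo fps_X ^ 3"
  by (subst fps_compose_assoc[symmetric])
     (simp_all add: fps_X_power_compose flip: power_mult)

text \<open>
  With \<open>F\<close> for \<open>jacobi_fps\<close>, square the dissection \<open>F = C(X\<^sup>3) - 3 X J(X\<^sup>3)\<close>, where \<open>J = F(X\<^sup>3)\<close>, and multiply by \<open>X\<close>. Two of the three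
  terms have only exponents that are \<open>1\<close> or \<open>2\<close> modulo \<open>3\<close>; what remains is \<open>9 X\<^sup>3 J(X\<^sup>3)\<^sup>2\<close>.
\<close>
lemma fps_trisect_X_mult_jacobi_fps_sq:
  "fps_trisect (fps_X * jacobi_fps ^ 2) = 9 * fps_X * (jacobi_fps oo fps_X ^ 3) ^ 2"
proof -
  define C where "C = fps_trisect jacobi_fps"
  define J where "J = jacobi_fps oo fps_X ^ 3"
  have mult: "(F * G) oo fps_X ^ 3 = (F oo fps_X ^ 3) * (G oo fps_X ^ 3)" for F G :: "complex fps"
    by (rule fps_compose_mult_distrib) simp
  have dis: "jacobi_fps = (C oo fps_X ^ 3) - 3 * fps_X * (J oo fps_X ^ 3)"
    unfolding C_def J_def fps_compose_X_power_9[symmetric] by (rule jacobi_fps_3_dissection)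
  have "fps_X * jacobi_fps ^ 2 =
      (C * C oo fps_X ^ 3) * fps_X + ((-6) * (C * J) oo fps_X ^ 3) * fps_X ^ 2
      + (9 * fps_X * (J * J) oo fps_X ^ 3) * 1"
    unfolding dis mult by (simp add: power2_eq_square power3_eq_cube algebra_simps)
  also have "fps_trisect \<dots> = C * C * fps_trisect fps_X + (-6) * (C * J) * fps_trisect (fps_X ^ 2)
      + 9 * fps_X * (J * J) * fps_trisect 1"
    unfolding fps_trisect_add fps_trisect_compose_mult ..
  also have "fps_trisect fps_X = (0 :: complex fps)"
    by (auto simp: fps_eq_iff)
  also have "fps_trisect (fps_X ^ 2) = (0 :: complex fps)"
    by (auto simp: fps_eq_iff) presburger
  also have "fps_trisect 1 = (1 :: complex fps)"
    by (auto simp: fps_eq_iff)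
  finally show ?thesis by (simp add: J_def power2_eq_square)
qed

section \<open>The eta product is an eigenfunction of trisection\<close>

definition eta_product_fps :: "complex fps" where
  "eta_product_fps = 27 * fps_X * (jacobi_fps oo fps_X ^ 3) ^ 2 * jacobi_fps ^ 2"

text \<open>
  With \<open>F\<close> for \<open>jacobi_fps\<close>, the factor \<open>F(X\<^sup>3)\<^sup>2\<close> leaves the trisection as \<open>F\<^sup>2\<close>, and \<open>X F\<^sup>2\<close> becomes \<open>9 X F(X\<^sup>3)\<^sup>2\<close>: the two factors swap
  roles, at the cost of a factor \<open>9\<close>.
\<close>
lemma fps_trisect_eta_product: "fps_trisect eta_product_fps = 9 * eta_product_fps"
proof -
  have "eta_product_fps = (27 * jacobi_fps ^ 2 oo fps_X ^ 3) * (fps_X * jacobi_fps ^ 2)"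
    by (simp add: eta_product_fps_def fps_compose_mult_distrib fps_compose_power mult_ac)
  also have "fps_trisect \<dots> = 27 * jacobi_fps ^ 2 * (9 * fps_X * (jacobi_fps oo fps_X ^ 3) ^ 2)"
    unfolding fps_trisect_compose_mult fps_trisect_X_mult_jacobi_fps_sq ..
  finally show ?thesis by (simp add: eta_product_fps_def mult_ac)
qed

lemma eta_product_fps_nth_3_power: "fps_nth eta_product_fps (3 ^ l * n) = 9 ^ l * fps_nth eta_product_fps n"
proof (induction l)
  case (Suc l)
  have "fps_nth eta_product_fps (3 ^ Suc l * n) = fps_nth (fps_trisect eta_product_fps) (3 ^ l * n)"
    by (simp add: mult_ac)
  also have "\<dots> = 9 * fps_nth eta_product_fps (3 ^ l * n)"
    by (simp add: fps_trisect_eta_product numeral_fps_const)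
  finally show ?case using Suc by simp
qed simp

lemma fps_mult_nth_Ints:
  assumes "\<And>n. fps_nth F n \<in> \<int>" "\<And>n. fps_nth G n \<in> \<int>"
  shows "fps_nth (F * G) n \<in> \<int>"
  unfolding fps_mult_nth using assms by (intro Ints_sum Ints_mult)

lemma eta_product_fps_nth_Ints: "fps_nth eta_product_fps n \<in> \<int>"
  unfolding eta_product_fps_def power2_eq_square
  by (intro fps_mult_nth_Ints)
     (auto simp: fps_nth_compose_X_power jacobi_fps_nth_Ints numeral_fps_const)

lemma eta_product_has_fps_expansion:
  "(\<lambda>q. 27 * q * qpochhammer_inf (q ^ 3) (q ^ 3) ^ 6 * qpochhammer_inf q q ^ 6)
     has_fps_expansion eta_product_fps"
proof -
  have J: "(\<lambda>q. qpochhammer_inf q q ^ 3) has_fps_expansion jacobi_fps"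
    using has_fps_expansion_of_sums_in_unit_disc[OF jacobi_fps_sums] by (simp add: fps_nth_inverse)
  have "(\<lambda>q. 27 * q * (qpochhammer_inf (q ^ 3) (q ^ 3) ^ 3) ^ 2 * (qpochhammer_inf q q ^ 3) ^ 2)
     has_fps_expansion eta_product_fps"
    unfolding eta_product_fps_def
    by (intro has_fps_expansion_mult has_fps_expansion_power J has_fps_expansion_compose_cube[OF J]
          has_fps_expansion_fps_X has_fps_expansion_numeral)
  thus ?thesis by (simp flip: power_mult)
qed

section \<open>The congruences\<close>

theorem theorem3p1:
  fixes u v :: "nat \<Rightarrow> complex"
  assumes u: "\<And>q :: complex. norm q < 1 \<Longrightarrow>
      (\<lambda>n. u n * q ^ n) sums (3 ^ 5 / 504 * (Eisenstein_E6 (q ^ 3) - Eisenstein_E6 q))"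
    and v: "\<And>q :: complex. norm q < 1 \<Longrightarrow>
      (\<lambda>n. v n * q ^ n) sums
        (27 * q * qpochhammer_inf (q ^ 3) (q ^ 3) ^ 6 * qpochhammer_inf q q ^ 6)"
  shows "\<forall>l n :: nat.
      (\<exists>a :: int. u (3 ^ l * n) = of_int a \<and> [a = 0] (mod 3 ^ (5 * l))) \<and>
      (\<exists>b :: int. v (3 ^ l * n) = of_int b \<and> [b = 0] (mod 3 ^ (2 * l)))"
proof (intro allI conjI)
  fix l n :: nat
  let ?\<sigma> = "\<lambda>n. int (divisor_power_sum 5 n)"
  have "Abs_fps u = Abs_fps (\<lambda>n. 3 ^ 5 * of_int (?\<sigma> n - (if 3 dvd n then ?\<sigma> (n div 3) else 0)))"
    using has_fps_expansion_of_sums_in_unit_disc[OF u] E6_difference_has_fps_expansion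
    by (rule fps_expansion_unique_complex)
  hence u_eq: "u n = of_int (3 ^ 5 * (?\<sigma> n - (if 3 dvd n then ?\<sigma> (n div 3) else 0)))" for n
    by (simp add: fps_eq_iff)
  show "\<exists>a :: int. u (3 ^ l * n) = of_int a \<and> [a = 0] (mod 3 ^ (5 * l))"
  proof (cases l)
    case 0
    show ?thesis unfolding u_eq by (intro exI conjI, rule refl) (simp add: 0 cong_def)
  next
    case (Suc m)
    have "u (3 ^ l * n) = of_int (3 ^ 5 * (?\<sigma> (3 ^ Suc m * n) - ?\<sigma> (3 ^ m * n)))"
      unfolding u_eq Suc by simp
    moreover have "(3::int) ^ (5 * Suc m) dvd ?\<sigma> (3 ^ Suc m * n) - ?\<sigma> (3 ^ m * n)"
      using divisor_power_sum_diff_dvd[of 3 5 m n] by simp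
    ultimately show ?thesis unfolding cong_0_iff Suc by (blast intro: dvd_mult)
  qed
  have "Abs_fps v = eta_product_fps"
    using has_fps_expansion_of_sums_in_unit_disc[OF v] eta_product_has_fps_expansion
    by (rule fps_expansion_unique_complex)
  hence v_eq: "v n = fps_nth eta_product_fps n" for n by (auto simp: fps_eq_iff)
  obtain b where "fps_nth eta_product_fps n = of_int b"
    using eta_product_fps_nth_Ints[of n] by (rule Ints_cases)
  hence "v (3 ^ l * n) = of_int (3 ^ (2 * l) * b)"
    by (simp add: v_eq eta_product_fps_nth_3_power power_mult)
  thus "\<exists>b :: int. v (3 ^ l * n) = of_int b \<and> [b = 0] (mod 3 ^ (2 * l))"
    unfolding cong_0_iff by (metis dvd_triv_left)
qed

end
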